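(* Let $\sigma_1<0$ and $\sigma_2>1$ be real, and for $t>0$ let $$S_A=\sum_{m_1=1}^{[t]}\sum_{m_2=1}^{[t]}\frac{1}{(m_1+m_2)^{\sigma_1+it}}\,\frac{1}{m_2^{\sigma_2-it}}.$$ Then $$|S_A|=O\left(t^{\frac12-\sigma_1}\ln t\right),\qquad t\to\infty.$$
   Context: $[A]$ denotes the integer part of $A$. The parameters $\sigma_1,\sigma_2$ are fixed, and the $O$-statement is for real $t\to\infty$ (the implied constant may depend on $\sigma_1,\sigma_2$). *)

theory Defs
  imports "HOL-Analysis.Analysis" "HOL-Library.Landau_Symbols"
begin

definition S_A :: "real \<Rightarrow> real \<Rightarrow> real \<Rightarrow> complex" where
  "S_A \<sigma>1 \<sigma>2 t =
    (\<Sum>m1 = 1..nat \<lfloor>t\<rfloor>. \<Sum>m2 = 1..nat \<lfloor>t\<rfloor>.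
      1 / (of_nat (m1 + m2) powr (complex_of_real \<sigma>1 + \<i> * complex_of_real t)) *
      (1 / (of_nat m2 powr (complex_of_real \<sigma>2 - \<i> * complex_of_real t))))"

end

theory Submission
  imports Defs
begin

text \<open>
  For fixed \<open>m2\<close> the sum over \<open>m1\<close> is a sum of \<open>n powr (- \<sigma>1 - \<i> * t)\<close> over an interval of
  integers \<open>n \<le> 2 * t\<close>. Since \<open>\<sigma>2 > 1\<close> it suffices to bound it uniformly in \<open>m2\<close>, and by
  Abel summation with the increasing weights \<open>n powr - \<sigma>1\<close> one needs only
  \<open>\<Sum>n. n powr (\<i> * t) = O(sqrt t * ln t)\<close>.
  The terms \<open>n < sqrt t\<close> are bounded trivially. The others are grouped by the integer part \<open>k\<close>
  of \<open>t * ln (1 + 1/n) / (2 * pi)\<close>, the phase increment in turns. Within a group the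
  increments decrease with gaps of order at least \<open>\<delta> = (k + 1)\<^sup>2 / t\<close>. At most \<open>O(1 / sqrt \<delta>)\<close>
  of them lie within \<open>sqrt \<delta>\<close> of an integer, and the Kusmin--Landau inequality bounds
  the sum over the others by \<open>O(1 / sqrt \<delta>)\<close>. Summing \<open>sqrt t / (k + 1)\<close> over \<open>k \<le> sqrt t\<close>
  gives the factor \<open>ln t\<close>.
\<close>

section \<open>Abel summation with increasing weights\<close>

lemma norm_sum_increasing_weights_le:
  fixes z :: "nat \<Rightarrow> 'a::real_normed_vector" and w :: "nat \<Rightarrow> real"
  assumes "a \<le> b"
    and partial: "\<And>j. a \<le> j \<Longrightarrow> j \<le> b \<Longrightarrow> norm (\<Sum>n = a..<j. z n) \<le> B"
    and mono: "\<And>j. a \<le> j \<Longrightarrow> j < b \<Longrightarrow> w j \<le> w (Suc j)"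
    and nonneg: "0 \<le> w a"
  shows "norm (\<Sum>n = a..<b. w n *\<^sub>R z n) \<le> 2 * w b * B"
proof -
  have B: "0 \<le> B" using partial[of a] assms(1) by simp
  \<comment> \<open>Abel summation as an induction: each step adds a partial sum weighted by the
    increase of \<open>w\<close>, so the bounds telescope. The second conjunct later gives
    \<open>0 \<le> w b\<close>.\<close>
  have main: "norm ((\<Sum>n = a..<j. w n *\<^sub>R z n) - w j *\<^sub>R (\<Sum>n = a..<j. z n)) \<le> (w j - w a) * B \<and> w a \<le> w j"
    if "a \<le> j" "j \<le> b" for j
    using that
  proof (induction j rule: dec_induct)
    case base
    show ?case by simp
  next
    case (step j)
    have w: "w j \<le> w (Suc j)" using mono[of j] step by simp
    have "(\<Sum>n = a..<Suc j. w n *\<^sub>R z n) - w (Suc j) *\<^sub>R (\<Sum>n = a..<Suc j. z n)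
       = ((\<Sum>n = a..<j. w n *\<^sub>R z n) - w j *\<^sub>R (\<Sum>n = a..<j. z n))
          + (w j - w (Suc j)) *\<^sub>R (\<Sum>n = a..<Suc j. z n)"
      using step(1) by (simp add: algebra_simps)
    also have "norm \<dots> \<le> (w j - w a) * B + (w (Suc j) - w j) * B"
    proof (rule norm_triangle_mono)
      show "norm ((\<Sum>n = a..<j. w n *\<^sub>R z n) - w j *\<^sub>R (\<Sum>n = a..<j. z n)) \<le> (w j - w a) * B"
        using step by simp
      show "norm ((w j - w (Suc j)) *\<^sub>R (\<Sum>n = a..<Suc j. z n)) \<le> (w (Suc j) - w j) * B"
        using w partial[of "Suc j"] step by (simp add: mult_left_mono)
    qed
    finally show ?case using w step by (simp add: algebra_simps)
  qed
  have "norm (\<Sum>n = a..<b. w n *\<^sub>R z n) \<le>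
     norm ((\<Sum>n = a..<b. w n *\<^sub>R z n) - w b *\<^sub>R (\<Sum>n = a..<b. z n)) + norm (w b *\<^sub>R (\<Sum>n = a..<b. z n))"
    using norm_triangle_sub by (metis add.commute)
  also have "\<dots> \<le> (w b - w a) * B + w b * B"
    using main[of b] partial[of b] assms(1) nonneg by (intro add_mono) (auto intro: mult_left_mono)
  also have "\<dots> \<le> 2 * w b * B"
    using B nonneg by (simp add: algebra_simps)
  finally show ?thesis .
qed

section \<open>The Kusmin-Landau inequality\<close>

lemma cot_antimono:
  fixes x y :: real
  assumes "0 < x" "x \<le> y" "y < pi"
  shows "cot y \<le> cot x"
proof -
  have s: "sin x > 0" "sin y > 0" using assms by (auto intro: sin_gt_zero)
  have "cot x - cot y = sin (y - x) / (sin x * sin y)"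
    using s by (simp add: cot_def sin_diff field_simps)
  also have "\<dots> \<ge> 0" using s assms by (intro divide_nonneg_pos) (auto intro!: sin_ge_zero)
  finally show ?thesis by simp
qed

text \<open>The constant real part 1/2 is the point: as \<open>x\<close> varies, only the imaginary
  part of this inverse moves, and it follows the monotone function \<open>cot\<close>.\<close>

lemma one_minus_cis_mult_cot:
  fixes x :: real
  assumes "sin x \<noteq> 0"
  shows "(1 - cis (2 * x)) * Complex (1/2) (cot x / 2) = 1"
proof -
  have *: "cos x * cos x = 1 - sin x * sin x"
    using sin_cos_squared_add[of x] by (simp add: power2_eq_square)
  have "cis (2 * x) = Complex (1 - 2 * (sin x * sin x)) (2 * sin x * cos x)"
    by (simp add: complex_eq_iff sin_double cos_double power2_eq_square *)
  then show ?thesis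
    using assms by (simp add: complex_eq_iff cot_def *)
qed

text \<open>Here \<open>x n\<close> is half of the phase increment. The identity
  \<open>z n = (z n - z (Suc n)) * c n\<close> with \<open>c n = 1 / (1 - cis (2 * x n)) = (1 + \<i> * cot (x n)) / 2\<close>
  allows summation by parts, and the total variation of \<open>c\<close> telescopes as \<open>cot\<close> is monotone.\<close>

lemma kusmin_landau:
  fixes z :: "nat \<Rightarrow> complex" and x :: "nat \<Rightarrow> real"
  assumes norm_z: "\<And>n. norm (z n) = 1"
    and step: "\<And>n. a \<le> n \<Longrightarrow> n < b \<Longrightarrow> z (Suc n) = z n * cis (2 * x n)"
    and antimono: "\<And>n. a \<le> n \<Longrightarrow> Suc n < b \<Longrightarrow> x (Suc n) \<le> x n"
    and range: "\<And>n. a \<le> n \<Longrightarrow> n < b \<Longrightarrow> 0 < x n \<and> x n < pi"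
    and sin: "\<And>n. a \<le> n \<Longrightarrow> n < b \<Longrightarrow> s \<le> sin (x n)"
    and s: "0 < s"
  shows "norm (\<Sum>n = a..<b. z n) \<le> 3 / s"
proof (cases "a < b")
  case False
  then show ?thesis using s by simp
next
  case True
  define c where "c n = Complex (1/2) (cot (x n) / 2)" for n
  have zc: "z n = (z n - z (Suc n)) * c n" if "a \<le> n" "n < b" for n
  proof -
    have "sin (x n) \<noteq> 0" using sin[OF that] s by simp
    from one_minus_cis_mult_cot[OF this] have "z n * ((1 - cis (2 * x n)) * c n) = z n"
      by (simp add: c_def)
    then show ?thesis by (simp add: step[OF that] algebra_simps)
  qed
  have cot: "\<bar>cot (x n)\<bar> \<le> 1 / s" if "a \<le> n" "n < b" for n
  proof -
    have "\<bar>cot (x n)\<bar> = \<bar>cos (x n)\<bar> / sin (x n)" using sin[OF that] s by (simp add: cot_def)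
    also have "\<dots> \<le> 1 / s" using sin[OF that] s by (intro frac_le) auto
    finally show ?thesis .
  qed
  \<comment> \<open>This absorbs the constant real part: \<open>1/2 + 1/(2 * s)\<close> is at most
    \<open>1/s\<close>.\<close>
  have s1: "1 \<le> 1 / s" using order_trans[OF sin[of a] sin_le_one] True s by simp
  have cn: "norm (c n) \<le> 1 / s" if "a \<le> n" "n < b" for n
  proof -
    have "norm (c n) \<le> \<bar>1/2\<bar> + \<bar>cot (x n) / 2\<bar>" unfolding c_def by (metis cmod_le complex.sel)
    then show ?thesis using cot[OF that] s1 by linarith
  qed
  \<comment> \<open>Summation by parts. With the boundary term \<open>z (Suc j) * c j\<close>
    included, passing from \<open>j\<close> to \<open>Suc j\<close> adds
    \<open>z (Suc j) * (c (Suc j) - c j)\<close>, whose norm is half the increase of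
    \<open>cot\<close>.\<close>
  have main: "norm ((\<Sum>n = a..<Suc j. z n) + z (Suc j) * c j) \<le> norm (c a) + (cot (x j) - cot (x a)) / 2"
    if "a \<le> j" "j < b" for j
    using that
  proof (induction j rule: dec_induct)
    case base
    have "z a + z (Suc a) * c a = z a * c a"
      using zc[of a] True by (simp add: algebra_simps)
    then show ?case by (simp add: norm_mult norm_z)
  next
    case (step j)
    have m: "cot (x j) \<le> cot (x (Suc j))"
      using range[of j] range[of "Suc j"] antimono[of j] step by (intro cot_antimono) auto
    have "(\<Sum>n = a..<Suc (Suc j). z n) + z (Suc (Suc j)) * c (Suc j)
       = ((\<Sum>n = a..<Suc j. z n) + z (Suc j) * c j) + z (Suc j) * (c (Suc j) - c j)"
      using zc[of "Suc j"] step by (simp add: algebra_simps)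
    also have "norm \<dots> \<le> (norm (c a) + (cot (x j) - cot (x a)) / 2) + (cot (x (Suc j)) - cot (x j)) / 2"
    proof (rule norm_triangle_mono)
      have "c (Suc j) - c j = \<i> * of_real ((cot (x (Suc j)) - cot (x j)) / 2)"
        by (simp add: c_def complex_eq_iff field_simps)
      then show "norm (z (Suc j) * (c (Suc j) - c j)) \<le> (cot (x (Suc j)) - cot (x j)) / 2"
        using m by (simp only: norm_mult norm_z norm_of_real norm_ii) simp
    qed (use step in simp)
    finally show ?case by (simp add: field_simps)
  qed
  define j where "j = b - 1"
  have j: "a \<le> j" "j < b" "Suc j = b" using True by (auto simp: j_def)
  have "norm (\<Sum>n = a..<b. z n) \<le> norm ((\<Sum>n = a..<Suc j. z n) + z (Suc j) * c j) + norm (z (Suc j) * c j)"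
    unfolding j(3) using norm_diff_ineq[of "\<Sum>n = a..<b. z n"] by (simp add: algebra_simps)
  also have "norm (z (Suc j) * c j) = norm (c j)"
    by (simp add: norm_mult norm_z)
  \<comment> \<open>The three contributions are the first coefficient, the total variation of
    \<open>c\<close> and the last boundary term, each at most \<open>1/s\<close>.\<close>
  also have "norm ((\<Sum>n = a..<Suc j. z n) + z (Suc j) * c j) + norm (c j) \<le> 1/s + (1/s + 1/s)/2 + 1/s"
  proof -
    have "(cot (x j) - cot (x a)) / 2 \<le> (1/s + 1/s) / 2"
      using cot[OF order_refl True] cot[OF j(1,2)] by (intro divide_right_mono) (auto simp: abs_le_iff)
    from order_trans[OF main[OF j(1,2)] add_mono[OF cn[OF order_refl True] this]] cn[OF j(1,2)]
    show ?thesis by (rule add_mono)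
  qed
  finally show ?thesis by simp
qed

section \<open>Sums whose phase increments are separated\<close>

lemma sin_ge_half:
  fixes x d :: real
  assumes "0 \<le> d" "d \<le> 1" "d \<le> x" "x \<le> pi - d"
  shows "d / 2 \<le> sin x"
proof -
  have 1: "d / 2 \<le> sin y" if "d \<le> y" "y \<le> pi / 2" for y
  proof -
    have "d / 2 \<le> sin d"
    proof -
      have "\<bar>sin d - d\<bar> \<le> d\<^sup>2 / 2"
        using Maclaurin_sin_bound[of d 2] by (simp add: sin_coeff_def numeral_2_eq_2)
      moreover have "d\<^sup>2 \<le> d" using assms by (simp add: power2_eq_square mult_left_le)
      ultimately show ?thesis by linarith
    qed
    also have "\<dots> \<le> sin y" using that assms by (intro sin_monotone_2pi_le) auto
    finally show ?thesis .
  qed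
  show ?thesis using 1[of x] 1[of "pi - x"] assms by (cases "x \<le> pi/2") auto
qed

text \<open>Preimages of intervals under a monotone sequence are convex; this turns sums over them
  into sums over ranges of indices.\<close>

lemma convex_nat_set_eq_interval:
  fixes S :: "nat set"
  assumes "finite S" and conv: "\<And>x y z. x \<in> S \<Longrightarrow> z \<in> S \<Longrightarrow> x \<le> y \<Longrightarrow> y \<le> z \<Longrightarrow> y \<in> S"
  obtains p q where "S = {p..<q}"
proof (cases "S = {}")
  case True
  then show ?thesis using that[of 0 0] by simp
next
  case False
  have "S = {Min S..<Suc (Max S)}"
  proof
    show "S \<subseteq> {Min S..<Suc (Max S)}" using assms(1) by (auto simp: less_Suc_eq_le)
    show "{Min S..<Suc (Max S)} \<subseteq> S"
      using conv[OF Min_in Max_in] assms(1) False by (auto simp: less_Suc_eq_le)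
  qed
  then show ?thesis using that by blast
qed


text \<open>Counting gives at most \<open>1 + d/\<delta>\<close> terms with \<open>x n\<close>
  within \<open>d\<close> of either end of \<open>[0, pi]\<close>, and Kusmin-Landau bounds the rest
  by a multiple of \<open>1/d\<close>. The choice \<open>d = sqrt \<delta>\<close> balances the
  two.\<close>

lemma norm_sum_separated_phases_le:
  fixes z :: "nat \<Rightarrow> complex" and x :: "nat \<Rightarrow> real"
  assumes norm_z: "\<And>n. norm (z n) = 1"
    and step: "\<And>n. a \<le> n \<Longrightarrow> n < b \<Longrightarrow> z (Suc n) = z n * cis (2 * x n)"
    and gap: "\<And>n. a \<le> n \<Longrightarrow> Suc n < b \<Longrightarrow> x (Suc n) + \<delta> \<le> x n"
    and range: "\<And>n. a \<le> n \<Longrightarrow> n < b \<Longrightarrow> 0 \<le> x n \<and> x n \<le> pi"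
    and \<delta>: "0 < \<delta>" "\<delta> \<le> 1"
  shows "norm (\<Sum>n = a..<b. z n) \<le> 10 / sqrt \<delta>"
proof -
  define d where "d = sqrt \<delta>"
  have d: "0 < d" "d \<le> 1" "d * d = \<delta>" using \<delta> by (auto simp: d_def)
  have far: "x n + real (n - m) * \<delta> \<le> x m" if "a \<le> m" "m \<le> n" "n < b" for m n
    using that(2,3)
  proof (induction n rule: dec_induct)
    case (step n)
    then show ?case using gap[of n] that(1) by (simp add: Suc_diff_le algebra_simps)
  qed simp
  have anti: "x n \<le> x m" if "a \<le> m" "m \<le> n" "n < b" for m n
    using far[OF that] mult_nonneg_nonneg[of "real (n - m)" \<delta>] \<delta> by linarith
  have interval: "\<exists>p q. {n \<in> {a..<b}. x n \<in> J} = {p..<q}" if "is_interval J" for J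
  proof -
    have "\<exists>p q. S = {p..<q}" if "S = {n \<in> {a..<b}. x n \<in> J}" for S
    proof (rule convex_nat_set_eq_interval[of S])
      show "finite S" by (simp add: that)
      show "k \<in> S" if "i \<in> S" "j \<in> S" "i \<le> k" "k \<le> j" for i j k
        using that \<open>S = _\<close> anti[of i k] anti[of k j] \<open>is_interval J\<close>
        by (auto simp: is_interval_1)
    qed blast
    then show ?thesis by blast
  qed
  \<comment> \<open>The width of \<open>J\<close> is tested only for \<open>0 \<le> u\<close> and
    \<open>v \<le> pi\<close>, which admits the half-lines used below. The count is at most
    \<open>1 + d/\<delta> = 1 + 1/d\<close>, hence at most \<open>2/d\<close>.\<close>
  have short: "norm (\<Sum>n \<in> {n \<in> {a..<b}. x n \<in> J}. z n) \<le> 2 / d"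
    if J: "is_interval J" "\<And>u v. u \<in> J \<Longrightarrow> v \<in> J \<Longrightarrow> 0 \<le> u \<Longrightarrow> v \<le> pi \<Longrightarrow> v - u \<le> d" for J
  proof -
    obtain p q where pq: "{n \<in> {a..<b}. x n \<in> J} = {p..<q}" using interval[OF J(1)] by blast
    have "real (q - p) \<le> 2 / d"
    proof (cases "p < q")
      case True
      have mem: "p \<in> {n \<in> {a..<b}. x n \<in> J}" "q - 1 \<in> {n \<in> {a..<b}. x n \<in> J}"
        unfolding pq using True by auto
      have "real (q - 1 - p) * \<delta> \<le> x p - x (q - 1)"
        using far[of p "q - 1"] mem True by (simp add: algebra_simps del: of_nat_diff)
      also have "\<dots> \<le> d" using J(2)[of "x (q - 1)" "x p"] mem range[of p] range[of "q - 1"] by auto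
      finally have "real (q - 1 - p) * d * d \<le> 1 * d" using d by (simp add: mult.assoc)
      then have "real (q - 1 - p) * d \<le> 1" using d by (simp only: mult_le_cancel_right_pos)
      moreover have "real (q - p) = real (q - 1 - p) + 1" using True by simp
      ultimately have "real (q - p) * d \<le> 2" using d by (simp add: algebra_simps)
      then show ?thesis using d by (simp add: field_simps)
    qed (use d in simp)
    moreover have "norm (\<Sum>n = p..<q. z n) \<le> (\<Sum>n = p..<q. 1)"
      by (rule sum_norm_le) (simp add: norm_z)
    ultimately show ?thesis unfolding pq by simp
  qed
  let ?S = "\<lambda>J. {n \<in> {a..<b}. x n \<in> J}"
  have low: "norm (sum z (?S {..<d})) \<le> 2 / d" by (rule short) (auto simp: is_interval_1)
  have high: "norm (sum z (?S {pi-d<..})) \<le> 2 / d" by (rule short) (auto simp: is_interval_1)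
  have mid: "norm (sum z (?S {d..pi-d})) \<le> 6 / d"
  proof -
    obtain p q where pq: "?S {d..pi-d} = {p..<q}" using interval[of "{d..pi-d}"] by (auto simp: is_interval_1)
    have mem: "a \<le> n \<and> n < b \<and> d \<le> x n \<and> x n \<le> pi - d" if "p \<le> n" "n < q" for n
    proof -
      have "n \<in> ?S {d..pi-d}" unfolding pq using that by simp
      then show ?thesis by simp
    qed
    have "norm (\<Sum>n = p..<q. z n) \<le> 3 / (d / 2)"
    proof (rule kusmin_landau[where x = x])
      show "z (Suc n) = z n * cis (2 * x n)" if "p \<le> n" "n < q" for n
        using mem[OF that] step by blast
      show "x (Suc n) \<le> x n" if "p \<le> n" "Suc n < q" for n
        using mem[of n] mem[of "Suc n"] that anti[of n "Suc n"] by simp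
      show "0 < x n \<and> x n < pi" if "p \<le> n" "n < q" for n
        using mem[OF that] d by auto
      show "d / 2 \<le> sin (x n)" if "p \<le> n" "n < q" for n
        using mem[OF that] d by (intro sin_ge_half) auto
    qed (use d norm_z in auto)
    then show ?thesis unfolding pq by simp
  qed
  have "{a..<b} = ?S {..<d} \<union> (?S {d..pi-d} \<union> ?S {pi-d<..})"
    by auto
  then have "(\<Sum>n = a..<b. z n) = sum z (?S {..<d} \<union> (?S {d..pi-d} \<union> ?S {pi-d<..}))"
    by (rule arg_cong)
  also have "\<dots> = sum z (?S {..<d}) + (sum z (?S {d..pi-d}) + sum z (?S {pi-d<..}))"
    \<comment> \<open>\<open>d \<le> 1\<close> and \<open>pi > 3\<close> give
      \<open>d < pi - d\<close>, so the three pieces are disjoint.\<close>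
    using d pi_gt3 by (subst sum.union_disjoint; (subst sum.union_disjoint)?) auto
  also have "norm \<dots> \<le> 2 / d + (6 / d + 2 / d)"
    by (intro norm_triangle_mono low mid high)
  finally show ?thesis by (simp add: d_def)
qed

section \<open>Differences of logarithms and blocks of phases\<close>

lemma ln_Suc_diff_le:
  assumes "1 \<le> n"
  shows "ln (real (Suc n)) - ln (real n) \<le> 1 / real n"
proof -
  have "ln (real (Suc n)) - ln (real n) = ln (real (Suc n) / real n)"
    using assms by (simp add: ln_div)
  also have "\<dots> \<le> real (Suc n) / real n - 1"
    using assms by (intro ln_le_minus_one) auto
  also have "\<dots> = 1 / real n" using assms by (simp add: field_simps)
  finally show ?thesis .
qed

text \<open>The right side is \<open>- ln u\<close> for
  \<open>u = n * (n + 2) / (n + 1)^2 = 1 - 1 / (n + 1)^2\<close>, and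
  \<open>ln u \<le> u - 1\<close>.\<close>

lemma ln_second_difference_ge:
  assumes "1 \<le> n"
  shows "1 / (real (Suc n))\<^sup>2 \<le>
    (ln (real (Suc n)) - ln (real n)) - (ln (real (Suc (Suc n))) - ln (real (Suc n)))"
proof -
  let ?u = "real n * real (Suc (Suc n)) / (real (Suc n) * real (Suc n))"
  have "ln ?u \<le> ?u - 1"
    using assms by (intro ln_le_minus_one) auto
  moreover have "ln ?u = ln (real n) + ln (real (Suc (Suc n))) - 2 * ln (real (Suc n))"
    using assms by (simp add: ln_div ln_mult)
  moreover have "?u - 1 = - (1 / (real (Suc n))\<^sup>2)"
    by (simp add: power2_eq_square divide_simps) (simp add: algebra_simps)
  ultimately show ?thesis by linarith
qed

lemma cis_add_2pi_nat: "cis (y + 2 * pi * real k) = cis y"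
  by (simp flip: cis_mult)

text \<open>Between two consecutive multiples of \<open>2 * pi\<close>, the phase increments of \<open>n powr (\<i> * t)\<close>
  are separated by about \<open>t / n\<^sup>2\<close>, and \<open>n\<close> is about \<open>t / k\<close>.\<close>

lemma norm_sum_cis_ln_block_le:
  fixes t :: real and a b k :: nat
  assumes t: "1 \<le> t" and a: "1 \<le> a" and b: "real b \<le> 3 * t"
    and k: "(real k + 1)\<^sup>2 \<le> 18 * t"
    and lower: "\<And>n. a \<le> n \<Longrightarrow> n < b \<Longrightarrow> 2 * pi * real k \<le> t * (ln (real (Suc n)) - ln (real n))"
    and upper: "\<And>n. a \<le> n \<Longrightarrow> n < b \<Longrightarrow> t * (ln (real (Suc n)) - ln (real n)) \<le> 2 * pi * (real k + 1)"
  shows "norm (\<Sum>n = a..<b. cis (t * ln (real n))) \<le> 43 * sqrt t / (real k + 1)"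
proof -
  define h where "h n = t * (ln (real (Suc n)) - ln (real n))" for n
  \<comment> \<open>Removing \<open>k\<close> full turns from the increment and halving it lands in
    \<open>[0, pi]\<close>.\<close>
  define x where "x n = h n / 2 - pi * real k" for n
  \<comment> \<open>The 18 is 2 * 3^2: the 2 comes from halving the increments, the 3 from
    \<open>(k + 1) * Suc n \<le> 3 * t\<close> below.\<close>
  define \<delta> where "\<delta> = (real k + 1)\<^sup>2 / (18 * t)"
  have "norm (\<Sum>n = a..<b. cis (t * ln (real n))) \<le> 10 / sqrt \<delta>"
  proof (rule norm_sum_separated_phases_le[where x = x])
    show "cis (t * ln (real (Suc n))) = cis (t * ln (real n)) * cis (2 * x n)" for n
    proof -
      have "cis (t * ln (real n)) * cis (2 * x n) = cis (t * ln (real n) + 2 * x n + 2 * pi * real k)"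
        by (simp add: cis_mult cis_add_2pi_nat)
      also have "t * ln (real n) + 2 * x n + 2 * pi * real k = t * ln (real (Suc n))"
        by (simp add: x_def h_def field_simps)
      finally show ?thesis by simp
    qed
    show "0 \<le> x n \<and> x n \<le> pi" if "a \<le> n" "n < b" for n
      using lower[OF that] upper[OF that] by (simp add: x_def h_def algebra_simps)
    show "x (Suc n) + \<delta> \<le> x n" if n: "a \<le> n" "Suc n < b" for n
    proof -
      have n1: "1 \<le> n" using n a by simp
      \<comment> \<open>For \<open>k = 0\<close> this is the range of \<open>n\<close>. Otherwise
        the lower bound on the increment and \<open>ln (1 + 1/n) \<le> 1/n\<close> give
        \<open>4 * k * n \<le> t\<close>, and
        \<open>(k + 1) * (n + 1) \<le> 4 * k * n\<close>.\<close>
      have kn: "(real k + 1) * real (Suc n) \<le> 3 * t"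
      proof (cases "k = 0")
        case True
        then show ?thesis using n b by simp
      next
        case False
        have "2 * pi * real k \<le> t * (1 / real n)"
          using lower[of n] n ln_Suc_diff_le[OF n1] t
          by (smt (verit) Suc_lessD mult_left_mono)
        then have "2 * pi * (real k * real n) \<le> t" using n1 by (simp add: field_simps)
        moreover have "2 * (real k * real n) \<le> pi * (real k * real n)"
          using pi_gt3 by (intro mult_right_mono) auto
        ultimately have "4 * (real k * real n) \<le> t" by linarith
        moreover have "(real k + 1) * (real n + 1) \<le> (2 * real k) * (2 * real n)"
          using False n1 by (intro mult_mono) auto
        ultimately show ?thesis using t by (simp add: algebra_simps)
      qed
      have "((real k + 1) * real (Suc n))\<^sup>2 \<le> (3 * t)\<^sup>2"
        using kn by (intro power_mono) auto
      then have "(real k + 1)\<^sup>2 * (real (Suc n))\<^sup>2 \<le> 9 * (t * t)"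
        unfolding power_mult_distrib by (simp add: power2_eq_square)
      then have "\<delta> \<le> t * (1 / (real (Suc n))\<^sup>2) / 2"
        using t by (simp add: \<delta>_def divide_simps) (simp add: algebra_simps)
      also have "\<dots> \<le> t * ((ln (real (Suc n)) - ln (real n)) - (ln (real (Suc (Suc n))) - ln (real (Suc n)))) / 2"
        using ln_second_difference_ge[OF n1] t by (intro divide_right_mono mult_left_mono) auto
      also have "\<dots> = x n - x (Suc n)"
        by (simp add: x_def h_def algebra_simps diff_divide_distrib add_divide_distrib)
      finally show ?thesis by simp
    qed
    show "0 < \<delta>" "\<delta> \<le> 1" using t k by (auto simp: \<delta>_def)
  qed simp
  also have "10 / sqrt \<delta> = 10 * sqrt 18 * sqrt t / (real k + 1)"
    by (simp add: \<delta>_def real_sqrt_divide real_sqrt_mult)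
  also have "\<dots> \<le> 43 * sqrt t / (real k + 1)"
  proof -
    have "sqrt 18 \<le> 43 / 10" by (rule real_le_lsqrt) (auto simp: power2_eq_square)
    then show ?thesis using t by (intro divide_right_mono mult_right_mono) auto
  qed
  finally show ?thesis .
qed


section \<open>The exponential sum over \<open>n powr (\<i> * t)\<close>\<close>

lemma harm_le_one_plus_ln:
  assumes "1 \<le> n"
  shows "harm n \<le> 1 + ln (real n)"
proof -
  obtain m where "n = Suc m" using assms by (cases n) auto
  then show ?thesis
    using decseqD[OF decseq_harm_diff_ln, of 0 m] by (simp add: harm_expand)
qed

lemma norm_sum_cis_ln_le:
  fixes t :: real and a b :: nat
  assumes t: "exp 1 \<le> t" and a: "1 \<le> a" and b: "real b \<le> 3 * t"
  shows "norm (\<Sum>n = a..<b. cis (t * ln (real n))) \<le> 130 * (sqrt t * ln t)"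
proof -
  have t1: "1 \<le> t" using t exp_ge_add_one_self[of 1] by linarith
  have lnt: "1 \<le> ln t" using t t1 by (simp add: ln_ge_iff)
  have st: "1 \<le> sqrt t" using t1 by simp
  define h where "h n = t * (ln (real (Suc n)) - ln (real n))" for n
  define \<kappa> where "\<kappa> n = nat \<lfloor>h n / (2 * pi)\<rfloor>" for n
  define K where "K = Suc (nat \<lfloor>sqrt t\<rfloor>)"
  let ?z = "\<lambda>n. cis (t * ln (real n))"
  \<comment> \<open>From \<open>sqrt t\<close> on, the increment is at most
    \<open>t/n \<le> sqrt t\<close>. Hence there are at most \<open>K\<close> groups, and
    \<open>(k + 1)^2\<close> stays below the \<open>18 * t\<close> that the block estimate
    requires.\<close>
  define A where "A = {n \<in> {a..<b}. real n < sqrt t}"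
  define A' where "A' = {n \<in> {a..<b}. sqrt t \<le> real n}"
  have K: "real K \<le> sqrt t + 1" using st by (simp add: K_def)
  have small: "norm (sum ?z A) \<le> sqrt t"
  proof -
    have "A \<subseteq> {1..nat \<lfloor>sqrt t\<rfloor>}" using a by (auto simp: A_def intro!: le_nat_floor)
    then have "card A \<le> card {1..nat \<lfloor>sqrt t\<rfloor>}" by (intro card_mono) auto
    then have "real (card A) \<le> real (nat \<lfloor>sqrt t\<rfloor>)" by simp
    also have "\<dots> \<le> sqrt t" using st by (intro of_nat_floor) simp
    finally have "real (card A) \<le> sqrt t" .
    moreover have "norm (sum ?z A) \<le> (\<Sum>n\<in>A. 1)" by (rule sum_norm_le) simp
    ultimately show ?thesis by simp
  qed
  have h: "0 \<le> h n" "h n \<le> sqrt t" if "n \<in> A'" for n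
  proof -
    have n: "1 \<le> n" "sqrt t \<le> real n" using that a by (auto simp: A'_def)
    show "0 \<le> h n" using n t1 by (auto simp: h_def)
    have "h n \<le> t * (1 / real n)"
      unfolding h_def using ln_Suc_diff_le[OF n(1)] t1 by (intro mult_left_mono) auto
    also have "\<dots> \<le> t * (1 / sqrt t)"
    proof (intro mult_left_mono divide_left_mono mult_pos_pos)
      show "0 < real n" using n(2) st by linarith
    qed (use n st t1 in auto)
    also have "\<dots> = sqrt t" using t1 by (simp add: real_div_sqrt)
    finally show "h n \<le> sqrt t" .
  qed
  \<comment> \<open>As \<open>h n\<close> is nonnegative here, \<open>nat\<close> does not truncate
    the floor.\<close>
  have \<kappa>_iff: "\<kappa> n = k \<longleftrightarrow> 2 * pi * real k \<le> h n \<and> h n < 2 * pi * (real k + 1)" if "n \<in> A'" for n k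
  proof -
    have "0 \<le> h n / (2 * pi)" using h(1)[OF that] by simp
    then have "\<kappa> n = k \<longleftrightarrow> \<lfloor>h n / (2 * pi)\<rfloor> = int k" by (auto simp: \<kappa>_def)
    also have "\<dots> \<longleftrightarrow> real k \<le> h n / (2 * pi) \<and> h n / (2 * pi) < real k + 1"
      by (simp add: floor_eq_iff)
    also have "\<dots> \<longleftrightarrow> 2 * pi * real k \<le> h n \<and> h n < 2 * pi * (real k + 1)"
      by (simp add: field_simps)
    finally show ?thesis .
  qed
  have \<kappa>_less: "\<kappa> n < K" if "n \<in> A'" for n
  proof -
    have "h n / (2 * pi) \<le> h n / 1" using h(1)[OF that] pi_gt3 by (intro divide_left_mono) auto
    then have "h n / (2 * pi) \<le> sqrt t" using h(2)[OF that] by simp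
    then have "\<kappa> n \<le> nat \<lfloor>sqrt t\<rfloor>" unfolding \<kappa>_def by (intro nat_mono floor_mono)
    then show ?thesis by (simp add: K_def)
  qed
  have h_anti: "h n \<le> h m" if "1 \<le> m" "m \<le> n" for m n
    using that(2,1)
  proof (induction n rule: dec_induct)
    case (step n)
    have "0 \<le> 1 / (real (Suc n))\<^sup>2" by simp
    also have "\<dots> \<le> (ln (real (Suc n)) - ln (real n)) - (ln (real (Suc (Suc n))) - ln (real (Suc n)))"
      using ln_second_difference_ge[of n] step by simp
    finally have "h (Suc n) \<le> h n" unfolding h_def using t1 by (intro mult_left_mono) auto
    then show ?case using step by simp
  qed simp
  have block: "norm (sum ?z {n \<in> A'. \<kappa> n = k}) \<le> 43 * sqrt t / (real k + 1)" if "k < K" for k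
  proof -
    let ?S = "{n \<in> A'. \<kappa> n = k}"
    have "\<exists>p q. ?S = {p..<q}"
    proof (rule convex_nat_set_eq_interval[of ?S])
      show "finite ?S" by (simp add: A'_def)
      show "l \<in> ?S" if "i \<in> ?S" "j \<in> ?S" "i \<le> l" "l \<le> j" for i j l
      proof -
        have l: "l \<in> A'" "1 \<le> i" using that a by (auto simp: A'_def)
        have "h l \<le> h i" "h j \<le> h l" using h_anti[of i l] h_anti[of l j] that l by auto
        then show ?thesis using \<kappa>_iff[of _ k] that l(1) by fastforce
      qed
    qed blast
    then obtain p q where pq: "?S = {p..<q}" by blast
    have mem: "n \<in> A' \<and> 2 * pi * real k \<le> h n \<and> h n < 2 * pi * (real k + 1)" if "p \<le> n" "n < q" for n
    proof -
      have "n \<in> ?S" unfolding pq using that by simp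
      then show ?thesis using \<kappa>_iff by blast
    qed
    show ?thesis
    \<comment> \<open>The endpoints of an empty block are unconstrained; membership of
      \<open>p\<close> and \<open>q - 1\<close> yields the range conditions only when
      \<open>p < q\<close>.\<close>
    proof (cases "p < q")
      case True
      have "norm (\<Sum>n = p..<q. ?z n) \<le> 43 * sqrt t / (real k + 1)"
      proof (rule norm_sum_cis_ln_block_le[OF t1])
        show "1 \<le> p" using mem[of p] True a by (auto simp: A'_def)
        have "q - 1 < b" using mem[of "q - 1"] True by (auto simp: A'_def)
        then show "real q \<le> 3 * t" using b by linarith
        have "real k + 1 \<le> 2 * sqrt t" using that K st by linarith
        then have "(real k + 1)\<^sup>2 \<le> (2 * sqrt t)\<^sup>2" by (intro power_mono) auto
        then show "(real k + 1)\<^sup>2 \<le> 18 * t" using t1 by (simp add: power_mult_distrib)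
      qed (use mem in \<open>auto simp: h_def less_imp_le\<close>)
      then show ?thesis unfolding pq .
    next
      case False
      then show ?thesis unfolding pq using t1 by simp
    qed
  qed
  have "norm (sum ?z A') \<le> 43 * sqrt t * harm K"
  proof -
    have "sum ?z A' = (\<Sum>k<K. sum ?z {n \<in> A'. \<kappa> n = k})"
      by (rule sum.group[symmetric]) (auto simp: A'_def \<kappa>_less)
    also have "norm \<dots> \<le> (\<Sum>k<K. 43 * sqrt t / (real k + 1))"
      by (rule sum_norm_le) (simp add: block)
    also have "\<dots> = 43 * sqrt t * harm K"
      by (simp add: harm_altdef sum_distrib_left divide_inverse add.commute)
    finally show ?thesis .
  qed
  \<comment> \<open>From \<open>K \<le> sqrt t + 1 \<le> exp 1 * t\<close> follows
    \<open>harm K \<le> 2 + ln t\<close>, and \<open>1 \<le> ln t\<close> turns this into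
    \<open>3 * ln t\<close>.\<close>
  also have "\<dots> \<le> 43 * sqrt t * (3 * ln t)"
  proof (intro mult_left_mono)
    have "harm K \<le> 1 + ln (real K)" by (rule harm_le_one_plus_ln) (simp add: K_def)
    also have "ln (real K) \<le> ln (exp 1 * t)"
    proof (rule ln_mono)
      have "sqrt t \<le> t" using t1 by (simp add: real_le_lsqrt self_le_power)
      moreover have "2 * t \<le> exp 1 * t" using exp_ge_add_one_self[of 1] t1 by (intro mult_right_mono) auto
      ultimately show "real K \<le> exp 1 * t" using K t1 by linarith
    qed (simp add: K_def)
    also have "\<dots> = 1 + ln t" using t1 by (simp add: ln_mult)
    finally show "harm K \<le> 3 * ln t" using lnt by simp
  qed (use st in simp)
  finally have large: "norm (sum ?z A') \<le> 129 * (sqrt t * ln t)" by simp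
  have "(\<Sum>n = a..<b. ?z n) = sum ?z (A \<union> A')"
    by (rule arg_cong[where f = "sum ?z"]) (auto simp: A_def A'_def)
  also have "\<dots> = sum ?z A + sum ?z A'"
    by (rule sum.union_disjoint) (auto simp: A_def A'_def)
  also have "norm \<dots> \<le> sqrt t + 129 * (sqrt t * ln t)"
    by (intro norm_triangle_mono small large)
  also have "\<dots> \<le> sqrt t * ln t + 129 * (sqrt t * ln t)" using lnt st by simp
  finally show ?thesis by simp
qed

section \<open>From phases to sums of complex powers\<close>

lemma inverse_of_nat_powr_complex:
  assumes "1 \<le> n"
  shows "1 / (of_nat n powr (complex_of_real \<sigma> + \<i> * complex_of_real t)) =
    (real n powr - \<sigma>) *\<^sub>R cnj (cis (t * ln (real n)))"
proof -
  have "1 / (of_nat n powr (complex_of_real \<sigma> + \<i> * complex_of_real t)) =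
    exp (complex_of_real (- \<sigma> * ln (real n)) + \<i> * complex_of_real (- (t * ln (real n))))"
    using assms by (simp add: powr_def exp_minus[symmetric] inverse_eq_divide[symmetric] algebra_simps)
  also have "\<dots> = exp (of_real (- \<sigma> * ln (real n))) * cis (- (t * ln (real n)))"
    unfolding cis_conv_exp exp_add ..
  also have "\<dots> = (real n powr - \<sigma>) *\<^sub>R cnj (cis (t * ln (real n)))"
    using assms by (simp add: powr_def scaleR_conv_of_real cis_cnj flip: exp_of_real)
  finally show ?thesis .
qed

lemma norm_sum_nat_powr_le:
  fixes \<sigma> t :: real and a b :: nat
  assumes \<sigma>: "\<sigma> \<le> 0" and t: "exp 1 \<le> t" and ab: "1 \<le> a" "a \<le> b" and b: "real b \<le> 3 * t"
  shows "norm (\<Sum>n = a..<b. 1 / (of_nat n powr (complex_of_real \<sigma> + \<i> * complex_of_real t)))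
    \<le> 260 * 3 powr - \<sigma> * (t powr (1/2 - \<sigma>) * ln t)"
proof -
  have t1: "1 \<le> t" using t exp_ge_add_one_self[of 1] by linarith
  \<comment> \<open>The powers rotate by \<open>- t * ln n\<close>, the phase sums by
    \<open>t * ln n\<close>; conjugation preserves the norm.\<close>
  have "(\<Sum>n = a..<b. 1 / (of_nat n powr (complex_of_real \<sigma> + \<i> * complex_of_real t))) =
      cnj (\<Sum>n = a..<b. (real n powr - \<sigma>) *\<^sub>R cis (t * ln (real n)))"
    unfolding cnj_sum using ab by (intro sum.cong refl) (simp add: inverse_of_nat_powr_complex)
  then have "norm (\<Sum>n = a..<b. 1 / (of_nat n powr (complex_of_real \<sigma> + \<i> * complex_of_real t))) =
      norm (\<Sum>n = a..<b. (real n powr - \<sigma>) *\<^sub>R cis (t * ln (real n)))"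
    by (simp only: complex_mod_cnj)
  also have "\<dots> \<le> 2 * real b powr - \<sigma> * (130 * (sqrt t * ln t))"
  proof (rule norm_sum_increasing_weights_le[OF ab(2)])
    show "norm (\<Sum>n = a..<j. cis (t * ln (real n))) \<le> 130 * (sqrt t * ln t)" if "a \<le> j" "j \<le> b" for j
      using that ab b by (intro norm_sum_cis_ln_le[OF t]) auto
  qed (use \<sigma> in \<open>auto intro!: powr_mono2\<close>)
  also have "\<dots> \<le> 2 * (3 * t) powr - \<sigma> * (130 * (sqrt t * ln t))"
    using b t1 \<sigma> by (intro mult_right_mono mult_left_mono powr_mono2) auto
  also have "\<dots> = 260 * 3 powr - \<sigma> * (t powr (1/2 - \<sigma>) * ln t)"
  proof -
    have "t powr (1/2 - \<sigma>) = sqrt t * t powr - \<sigma>"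
      using t1 powr_add[of t "1/2" "- \<sigma>"] by (simp add: powr_half_sqrt)
    then show ?thesis using t1 by (simp add: powr_mult)
  qed
  finally show ?thesis .
qed

section \<open>Summation over \<open>m2\<close>\<close>

theorem lemma4p1:
  fixes \<sigma>1 \<sigma>2 :: real
  assumes "\<sigma>1 < 0" and "\<sigma>2 > 1"
  shows "(\<lambda>t::real. norm (S_A \<sigma>1 \<sigma>2 t)) \<in> O[at_top](\<lambda>t. t powr (1/2 - \<sigma>1) * ln t)"
proof -
  \<comment> \<open>\<open>0 powr x = 0\<close> makes the term at \<open>m = 0\<close> vanish, so
    \<open>C\<close> is the zeta value at \<open>\<sigma>2\<close>.\<close>
  define C where "C = (\<Sum>m. real m powr - \<sigma>2)"
  define D where "D = 260 * 3 powr - \<sigma>1"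
  have summ: "summable (\<lambda>m. real m powr - \<sigma>2)"
    using assms(2) by (simp add: summable_real_powr_iff)
  have "norm (S_A \<sigma>1 \<sigma>2 t) \<le> (C * D) * (t powr (1/2 - \<sigma>1) * ln t)" if t: "exp 1 \<le> t" for t
  proof -
    have t1: "1 \<le> t" using t exp_ge_add_one_self[of 1] by linarith
    define N where "N = nat \<lfloor>t\<rfloor>"
    define B where "B = D * (t powr (1/2 - \<sigma>1) * ln t)"
    define u where "u n = 1 / (of_nat n powr (complex_of_real \<sigma>1 + \<i> * complex_of_real t))" for n :: nat
    define v where "v m = 1 / (of_nat m powr (complex_of_real \<sigma>2 - \<i> * complex_of_real t))" for m :: nat
    have N: "real N \<le> t" using t1 by (simp add: N_def)
    have B: "0 \<le> B" using t1 by (simp add: B_def D_def)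
    have inner: "norm (\<Sum>m1 = 1..N. u (m1 + m)) \<le> B" if "m \<le> N" for m
    proof -
      \<comment> \<open>The excluded endpoint \<open>Suc N + m\<close> can be as large as
        \<open>2 * t + 1\<close>, which \<open>1 \<le> t\<close> brings under the limit
        \<open>3 * t\<close> of the preceding bounds.\<close>
      have "(\<Sum>m1 = 1..N. u (m1 + m)) = (\<Sum>n = 1 + m..<Suc N + m. u n)"
        by (subst sum.shift_bounds_nat_ivl) (simp add: atLeastLessThanSuc_atLeastAtMost)
      also have "norm \<dots> \<le> B"
        unfolding u_def B_def D_def
        using assms(1) t that N t1 by (intro norm_sum_nat_powr_le) auto
      finally show ?thesis .
    qed
    have v: "norm (v m) = real m powr - \<sigma>2" if "1 \<le> m" for m
      using inverse_of_nat_powr_complex[OF that, of \<sigma>2 "- t"] by (simp add: v_def)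
    \<comment> \<open>Exchanging the order fixes the shift \<open>m\<close> in the inner sum, so
      \<open>inner\<close> applies uniformly and only the absolutely summable \<open>v m\<close>
      remain.\<close>
    have "S_A \<sigma>1 \<sigma>2 t = (\<Sum>m = 1..N. (\<Sum>m1 = 1..N. u (m1 + m)) * v m)"
      unfolding S_A_def N_def[symmetric] u_def[symmetric] v_def[symmetric]
      by (subst sum.swap) (simp add: sum_distrib_right)
    also have "norm \<dots> \<le> (\<Sum>m = 1..N. B * real m powr - \<sigma>2)"
      by (rule sum_norm_le) (use inner in \<open>auto simp: norm_mult v intro!: mult_right_mono\<close>)
    also have "\<dots> = B * (\<Sum>m = 1..N. real m powr - \<sigma>2)"
      by (simp add: sum_distrib_left)
    also have "\<dots> \<le> B * C"
      unfolding C_def using B summ by (intro mult_left_mono sum_le_suminf) auto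
    finally show ?thesis by (simp add: B_def mult_ac)
  qed
  note bound = this
  have "eventually (\<lambda>t. norm (norm (S_A \<sigma>1 \<sigma>2 t)) \<le>
      (C * D) * norm (t powr (1/2 - \<sigma>1) * ln t)) at_top"
    using eventually_ge_at_top[of "exp 1"]
  proof eventually_elim
    fix t :: real
    assume t: "exp 1 \<le> t"
    have "1 \<le> t" using t exp_ge_add_one_self[of 1] by linarith
    then show "norm (norm (S_A \<sigma>1 \<sigma>2 t)) \<le> (C * D) * norm (t powr (1/2 - \<sigma>1) * ln t)"
      using bound[OF t] by (simp add: abs_mult)
  qed
  then show ?thesis by (rule bigoI)
qed

end
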